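(* Let $p,q$ be coprime integers with $|p|+|q|>2$, let $n\ge1$, and let $A\in GL_n(\mathbb{C})$ be such that its only eigenvalue is $\lambda$, i.e. $\sigma(A)=\{\lambda\}$, with $\lambda^{q-p}=1$. Let $N=A-\lambda I_n$. Then: i) $A^p$ and $A^q$ are similar. ii) There exists a unique polynomial $P\in\mathbb{C}[X]$ of least degree such that, for every matrix of the form $C=B^{-1}AB$ with $B\in GL_n(\mathbb{C})$ satisfying $B^{-1}A^pB=A^q$, one has $C-\lambda I_n=P(N)$. iii) With this $P$, there exists an invertible matrix $B_0$ such that $B_0^{-1}NB_0=P(N)$, and the set of matrices $B\in GL_n(\mathbb{C})$ satisfying $B^{-1}A^pB=A^q$ is $\mathcal{C}(N)B_0=\{\Delta B_0\mid\Delta\in\mathcal{C}(N)\}$.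
   Context: $\sigma(A)$ is the set of distinct eigenvalues of $A$. For an $n\times n$ matrix $S$, $\mathcal{C}(S)=\{\Delta\in GL_n(\mathbb{C})\mid\Delta S=S\Delta\}$ is the set of invertible matrices commuting with $S$. *)

theory Defs
  imports "Jordan_Normal_Form.Spectral_Radius"
begin

abbreviation cmat_ring :: "nat \<Rightarrow> complex mat ring" where
  "cmat_ring n \<equiv> ring_mat TYPE(complex) n ()"

abbreviation GL :: "nat \<Rightarrow> complex mat set" where
  "GL n \<equiv> Units (cmat_ring n)"

definition mat_commutant :: "nat \<Rightarrow> complex mat \<Rightarrow> complex mat set" where
  "mat_commutant n S = {\<Delta> \<in> GL n. \<Delta> * S = S * \<Delta>}"

definition eval_mat :: "nat \<Rightarrow> complex poly \<Rightarrow> complex mat \<Rightarrow> complex mat" where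
  "eval_mat n P M =
    (\<Oplus>\<^bsub>cmat_ring n\<^esub> k\<in>{..degree P}. coeff P k \<cdot>\<^sub>m (M ^\<^sub>m k))"

(* Integer exponents: [^] is the HOL-Algebra power, so for p < 0 it is the inverse in
   cmat_ring n of a natural power; this is meaningful when A is in GL n. *)
definition power_conjugators :: "nat \<Rightarrow> complex mat \<Rightarrow> int \<Rightarrow> int \<Rightarrow> complex mat set" where
  "power_conjugators n A p q =
    {B \<in> GL n. inv\<^bsub>cmat_ring n\<^esub> B * (A [^]\<^bsub>cmat_ring n\<^esub> p) * B = A [^]\<^bsub>cmat_ring n\<^esub> q}"

definition conjugate_poly ::
    "nat \<Rightarrow> complex mat \<Rightarrow> int \<Rightarrow> int \<Rightarrow> complex \<Rightarrow> complex poly \<Rightarrow> bool" where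
  "conjugate_poly n A p q lam P \<longleftrightarrow>
    (\<forall>B \<in> power_conjugators n A p q.
      inv\<^bsub>cmat_ring n\<^esub> B * A * B - lam \<cdot>\<^sub>m 1\<^sub>m n = eval_mat n P (A - lam \<cdot>\<^sub>m 1\<^sub>m n))"

end

theory Submission
  imports
    Defs
    "Jordan_Normal_Form.Jordan_Normal_Form_Uniqueness"
    "HOL-Computational_Algebra.Polynomial_FPS"
begin

text \<open>
  Formal power series can be evaluated at the nilpotent matrix \<open>N\<close>, and
  \<open>A\<^sup>p = F(N)\<close> for \<open>F = (\<lambda> + X)\<^sup>p\<close>, also for negative \<open>p\<close>. After subtracting the constant
  coefficient \<open>\<lambda>\<^sup>p = \<lambda>\<^sup>q\<close>, the series for \<open>p\<close> and \<open>q\<close> become series \<open>f\<close> and \<open>h\<close> with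
  vanishing constant and nonvanishing linear coefficient, so that \<open>B\<^sup>-\<^sup>1 A\<^sup>p B = A\<^sup>q\<close>, that is
  \<open>f(B\<^sup>-\<^sup>1 N B) = h(N)\<close>, is equivalent to \<open>B\<^sup>-\<^sup>1 N B = P(N)\<close> with \<open>P = f\<^sup>-\<^sup>1 \<circ> h\<close>. Such a \<open>B\<close>
  exists because \<open>P(N)\<close> is similar to \<open>N\<close>: on a Jordan block \<open>J\<close>, the matrices \<open>P(J)\<close> and \<open>J\<close>
  are nilpotent with the same one-dimensional kernel.
\<close>

subsection \<open>Polynomials and power series at a matrix\<close>

lemma index_finsum_mat:
  assumes "finite K" "\<And>k. k \<in> K \<Longrightarrow> f k \<in> carrier_mat n n" "i < n" "j < n"
  shows "finsum (cmat_ring n) f K $$ (i, j) = (\<Sum>k\<in>K. f k $$ (i, j))"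
  using assms(1,2)
proof (induction K)
  case empty
  interpret ring "cmat_ring n" by (rule ring_mat)
  show ?case using assms(3,4) by (simp add: ring_mat_simps)
next
  case (insert x K)
  interpret ring "cmat_ring n" by (rule ring_mat)
  have f: "f \<in> K \<rightarrow> carrier (cmat_ring n)" "f x \<in> carrier (cmat_ring n)"
    using insert.prems by (auto simp: ring_mat_simps)
  have "finsum (cmat_ring n) f K \<in> carrier_mat n n"
    using finsum_closed[OF f(1)] by (simp add: ring_mat_simps)
  then show ?case
    using finsum_insert[OF insert.hyps f] insert assms(3,4) by (simp add: ring_mat_simps)
qed

lemma eval_mat_carrier [simp, intro]:
  assumes "M \<in> carrier_mat n n"
  shows "eval_mat n P M \<in> carrier_mat n n"
proof -
  interpret ring "cmat_ring n" by (rule ring_mat)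
  have "eval_mat n P M \<in> carrier (cmat_ring n)"
    unfolding eval_mat_def by (rule finsum_closed) (use assms in \<open>auto simp: ring_mat_simps\<close>)
  then show ?thesis by (simp add: ring_mat_simps)
qed

lemma eval_mat_dim [simp]:
  assumes "M \<in> carrier_mat n n"
  shows "dim_row (eval_mat n P M) = n" "dim_col (eval_mat n P M) = n"
  using eval_mat_carrier[OF assms] by blast+

text \<open>The bound \<open>m\<close> is free above the degree so that polynomials of different
  degrees can be compared over one range of summation.\<close>

lemma index_eval_mat:
  assumes M: "M \<in> carrier_mat n n" and "degree P \<le> m" and ij: "i < n" "j < n"
  shows "eval_mat n P M $$ (i, j) = (\<Sum>k\<le>m. coeff P k * (M ^\<^sub>m k) $$ (i, j))"
proof -
  have "eval_mat n P M $$ (i, j) = (\<Sum>k\<le>degree P. coeff P k * (M ^\<^sub>m k) $$ (i, j))"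
    unfolding eval_mat_def using assms by (subst index_finsum_mat) auto
  also have "\<dots> = (\<Sum>k\<le>m. coeff P k * (M ^\<^sub>m k) $$ (i, j))"
    using assms(2) by (intro sum.mono_neutral_left) (auto simp: coeff_eq_0)
  finally show ?thesis .
qed

lemma eval_mat_0 [simp]:
  assumes "M \<in> carrier_mat n n"
  shows "eval_mat n 0 M = 0\<^sub>m n n"
  by (rule eq_matI) (use assms in \<open>auto simp: index_eval_mat[where m = 0]\<close>)

text \<open>The Horner step, on which the inductions over polynomials below rest.\<close>

lemma eval_mat_pCons:
  assumes M: "M \<in> carrier_mat n n"
  shows "eval_mat n (pCons a P) M = a \<cdot>\<^sub>m 1\<^sub>m n + eval_mat n P M * M"
proof (rule eq_matI)
  fix i j assume "i < dim_row (a \<cdot>\<^sub>m 1\<^sub>m n + eval_mat n P M * M)"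
    "j < dim_col (a \<cdot>\<^sub>m 1\<^sub>m n + eval_mat n P M * M)"
  then have ij: "i < n" "j < n" using M by auto
  let ?m = "degree P"
  have "eval_mat n (pCons a P) M $$ (i, j)
      = (\<Sum>k\<le>Suc ?m. coeff (pCons a P) k * (M ^\<^sub>m k) $$ (i, j))"
    by (rule index_eval_mat[OF M degree_pCons_le ij])
  also have "\<dots> = a * 1\<^sub>m n $$ (i, j) + (\<Sum>k\<le>?m. coeff P k * (M ^\<^sub>m k * M) $$ (i, j))"
    using M by (subst sum.atMost_Suc_shift) simp
  also have "(\<Sum>k\<le>?m. coeff P k * (M ^\<^sub>m k * M) $$ (i, j))
      = (\<Sum>k\<le>?m. \<Sum>l<n. coeff P k * (M ^\<^sub>m k) $$ (i, l) * M $$ (l, j))"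
    using M ij by (intro sum.cong)
      (simp_all add: scalar_prod_def sum_distrib_left mult.assoc atLeast0LessThan)
  also have "\<dots> = (\<Sum>l<n. eval_mat n P M $$ (i, l) * M $$ (l, j))"
    using M ij by (subst sum.swap) (simp add: index_eval_mat[OF M le_refl] sum_distrib_right)
  also have "\<dots> = (eval_mat n P M * M) $$ (i, j)"
    using M ij by (simp add: scalar_prod_def atLeast0LessThan)
  finally show "eval_mat n (pCons a P) M $$ (i, j)
      = (a \<cdot>\<^sub>m 1\<^sub>m n + eval_mat n P M * M) $$ (i, j)"
    using M ij by simp
qed (use M in auto)

lemma eval_mat_add:
  assumes M: "M \<in> carrier_mat n n"
  shows "eval_mat n (P + Q) M = eval_mat n P M + eval_mat n Q M"
proof (rule eq_matI)
  fix i j assume "i < dim_row (eval_mat n P M + eval_mat n Q M)"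
    "j < dim_col (eval_mat n P M + eval_mat n Q M)"
  then have ij: "i < n" "j < n" using M by auto
  let ?m = "max (degree P) (degree Q)"
  show "eval_mat n (P + Q) M $$ (i, j) = (eval_mat n P M + eval_mat n Q M) $$ (i, j)"
    using M ij index_eval_mat[OF M _ ij, of "P + Q" ?m] index_eval_mat[OF M _ ij, of P ?m]
      index_eval_mat[OF M _ ij, of Q ?m]
    by (simp add: degree_add_le_max sum.distrib algebra_simps)
qed (use M in auto)

lemma eval_mat_smult:
  assumes M: "M \<in> carrier_mat n n"
  shows "eval_mat n (Polynomial.smult c P) M = c \<cdot>\<^sub>m eval_mat n P M"
  by (rule eq_matI) (use M in \<open>auto simp: index_eval_mat[where m = "degree P"] degree_smult_le
    sum_distrib_left mult.assoc\<close>)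

lemma eval_mat_diff:
  assumes M: "M \<in> carrier_mat n n"
  shows "eval_mat n (P - Q) M = eval_mat n P M - eval_mat n Q M"
proof -
  have "P - Q = P + Polynomial.smult (- 1) Q" by simp
  then have "eval_mat n (P - Q) M = eval_mat n P M + (- 1) \<cdot>\<^sub>m eval_mat n Q M"
    using M by (simp only: eval_mat_add eval_mat_smult)
  then show ?thesis using M by (auto intro!: eq_matI)
qed

lemma eval_mat_const:
  assumes "M \<in> carrier_mat n n"
  shows "eval_mat n [:c:] M = c \<cdot>\<^sub>m 1\<^sub>m n"
  using assms by (simp add: eval_mat_pCons)

lemma eval_mat_X:
  assumes "M \<in> carrier_mat n n"
  shows "eval_mat n [:0, 1:] M = M"
  using assms by (simp add: eval_mat_pCons) (auto intro!: eq_matI)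

text \<open>Inducting on the right factor keeps the Horner factor \<open>M\<close> on the far right,
  so no commutation of \<open>M\<close> with \<open>eval_mat n P M\<close> has to be shown.\<close>

lemma eval_mat_mult:
  assumes M: "M \<in> carrier_mat n n"
  shows "eval_mat n (P * Q) M = eval_mat n P M * eval_mat n Q M"
proof (induction Q)
  case 0
  show ?case using M by (simp add: right_mult_zero_mat[of _ n n])
next
  case (pCons b Q)
  let ?P = "eval_mat n P M" and ?Q = "eval_mat n Q M"
  have "eval_mat n (P * pCons b Q) M = b \<cdot>\<^sub>m ?P + ?P * ?Q * M"
    using M by (simp add: mult_pCons_right eval_mat_add eval_mat_smult eval_mat_pCons pCons.IH)
      (auto intro!: eq_matI)
  also have "\<dots> = ?P * (b \<cdot>\<^sub>m 1\<^sub>m n + ?Q * M)"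
    using M by (subst mult_add_distrib_mat[of _ n n _ n])
      (auto simp: mult_smult_distrib[of _ n n _ n] assoc_mult_mat[of _ n n _ n _ n])
  finally show ?case using M by (simp add: eval_mat_pCons)
qed

lemma eval_mat_pcompose:
  assumes M: "M \<in> carrier_mat n n"
  shows "eval_mat n (pcompose P Q) M = eval_mat n P (eval_mat n Q M)"
proof (induction P)
  case (pCons a P)
  have "pcompose (pCons a P) Q = [:a:] + pcompose P Q * Q"
    by (simp add: pcompose_pCons mult.commute)
  then have "eval_mat n (pcompose (pCons a P) Q) M
      = a \<cdot>\<^sub>m 1\<^sub>m n + eval_mat n P (eval_mat n Q M) * eval_mat n Q M"
    using M by (simp only: eval_mat_add eval_mat_const eval_mat_mult pCons.IH)
  then show ?case
    using M by (simp only: eval_mat_pCons eval_mat_carrier)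
qed (use M in simp)

text \<open>Conjugation respects each Horner step because the inner \<open>T * S\<close> cancels;
  hence one pair of witnesses serves all polynomials.\<close>

lemma similar_mat_wit_eval_mat:
  assumes wit: "similar_mat_wit A B S T" and A: "A \<in> carrier_mat n n"
  shows "similar_mat_wit (eval_mat n P A) (eval_mat n P B) S T"
proof -
  note w = similar_mat_witD2[OF A wit]
  have "eval_mat n P A = S * eval_mat n P B * T"
  proof (induction P)
    case 0
    show ?case using w by (simp add: right_mult_zero_mat[of _ n n])
  next
    case (pCons a P)
    let ?E = "eval_mat n P B"
    have E: "?E \<in> carrier_mat n n" using w by auto
    have "(S * ?E * T) * (S * B * T) = S * (?E * (T * S) * B) * T"
      using w(4-7) E by (simp add: assoc_mult_mat[of _ n n _ n _ n] del: eval_mat_carrier)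
    also have "\<dots> = S * (?E * B) * T"
      using w E by simp
    finally have "(S * ?E * T) * A = S * (?E * B) * T"
      unfolding w(3)[symmetric] .
    then have 1: "eval_mat n (pCons a P) A = a \<cdot>\<^sub>m (S * T) + S * (?E * B) * T"
      unfolding eval_mat_pCons[OF A] pCons.IH w(1) by simp
    have "S * (a \<cdot>\<^sub>m 1\<^sub>m n + X) * T = a \<cdot>\<^sub>m (S * T) + S * X * T"
      if X: "X \<in> carrier_mat n n" for X
    proof -
      have "S * (a \<cdot>\<^sub>m 1\<^sub>m n + X) * T = (S * (a \<cdot>\<^sub>m 1\<^sub>m n) + S * X) * T"
        using w(6) X by (subst mult_add_distrib_mat[of _ n n _ n]) auto
      also have "S * (a \<cdot>\<^sub>m 1\<^sub>m n) = a \<cdot>\<^sub>m S"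
        using w(6) by (simp add: mult_smult_distrib[of _ n n _ n])
      also have "(a \<cdot>\<^sub>m S + S * X) * T = a \<cdot>\<^sub>m S * T + S * X * T"
        using w(6,7) X by (subst add_mult_distrib_mat[of _ n n]) auto
      finally show ?thesis
        using w(6,7) by (simp add: mult_smult_assoc_mat[of _ n n])
    qed
    from this[of "?E * B"] show ?case
      using 1 w(5) E by (simp add: eval_mat_pCons)
  qed
  then show ?thesis
    using w by (intro similar_mat_witI[of S T n]) auto
qed

section \<open>Power series at nilpotent matrices\<close>

lemma pow_mat_nilpotent_ge:
  assumes "N \<in> carrier_mat n n" "N ^\<^sub>m m = 0\<^sub>m n n" "m \<le> k"
  shows "N ^\<^sub>m k = 0\<^sub>m n n"
  using assms(3)
proof (induction k rule: dec_induct)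
  case (step k)
  then show ?case using assms by simp
qed (use assms in simp)

lemma eval_mat_nilpotent_cong:
  assumes N: "N \<in> carrier_mat n n" "N ^\<^sub>m m = 0\<^sub>m n n"
    and eq: "\<And>k. k < m \<Longrightarrow> coeff P k = coeff Q k"
  shows "eval_mat n P N = eval_mat n Q N"
proof (rule eq_matI)
  fix i j assume "i < dim_row (eval_mat n Q N)" "j < dim_col (eval_mat n Q N)"
  then have ij: "i < n" "j < n" using N by auto
  let ?d = "max (degree P) (degree Q)"
  have "coeff P k * (N ^\<^sub>m k) $$ (i, j) = coeff Q k * (N ^\<^sub>m k) $$ (i, j)" for k
    using eq[of k] pow_mat_nilpotent_ge[OF N, of k] ij by (cases "k < m") auto
  then have "(\<Sum>k\<le>?d. coeff P k * (N ^\<^sub>m k) $$ (i, j)) = (\<Sum>k\<le>?d. coeff Q k * (N ^\<^sub>m k) $$ (i, j))"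
    by (intro sum.cong refl)
  then show "eval_mat n P N $$ (i, j) = eval_mat n Q N $$ (i, j)"
    using index_eval_mat[OF N(1) _ ij, of P ?d] index_eval_mat[OF N(1) _ ij, of Q ?d] by simp
qed (use N in auto)

text \<open>By Cayley-Hamilton a nilpotent matrix of size \<open>n\<close> has vanishing
  \<open>n\<close>-th power, so these are all of them; the uniform exponent lets one truncation
  order serve every matrix of that size.\<close>

definition nilpotent_mats :: "nat \<Rightarrow> complex mat set" where
  "nilpotent_mats n = {N \<in> carrier_mat n n. N ^\<^sub>m n = 0\<^sub>m n n}"

text \<open>This is the value F(N): the terms of order at least \<open>n\<close> that are cut off
  vanish at a matrix in \<open>nilpotent_mats n\<close>.\<close>

definition fps_mat :: "nat \<Rightarrow> complex fps \<Rightarrow> complex mat \<Rightarrow> complex mat" where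
  "fps_mat n F N = eval_mat n (truncate_fps n F) N"

lemma nilpotent_matsD:
  assumes "N \<in> nilpotent_mats n"
  shows "N \<in> carrier_mat n n" "N ^\<^sub>m n = 0\<^sub>m n n"
  using assms by (auto simp: nilpotent_mats_def)

lemma fps_mat_carrier [simp, intro]:
  "N \<in> nilpotent_mats n \<Longrightarrow> fps_mat n F N \<in> carrier_mat n n"
  by (simp add: fps_mat_def nilpotent_matsD)

lemma eval_mat_eq_fps_mat:
  assumes "N \<in> nilpotent_mats n" "\<And>k. k < n \<Longrightarrow> coeff P k = fps_nth F k"
  shows "eval_mat n P N = fps_mat n F N"
  unfolding fps_mat_def
  by (rule eval_mat_nilpotent_cong[where m = n])
     (use assms in \<open>auto simp: nilpotent_matsD coeff_truncate_fps\<close>)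

lemma fps_mat_cong:
  assumes "N \<in> nilpotent_mats n" "\<And>k. k < n \<Longrightarrow> fps_nth F k = fps_nth G k"
  shows "fps_mat n F N = fps_mat n G N"
  by (subst fps_mat_def, rule eval_mat_eq_fps_mat)
     (use assms in \<open>auto simp: coeff_truncate_fps\<close>)

lemma fps_mat_const:
  assumes "N \<in> nilpotent_mats n"
  shows "fps_mat n (fps_const c) N = c \<cdot>\<^sub>m 1\<^sub>m n"
  using eval_mat_eq_fps_mat[OF assms, of "[:c:]" "fps_const c"] nilpotent_matsD[OF assms]
  by (auto simp: eval_mat_const coeff_pCons split: nat.splits)

lemma fps_mat_X:
  assumes "N \<in> nilpotent_mats n"
  shows "fps_mat n fps_X N = N"
  using eval_mat_eq_fps_mat[OF assms, of "[:0, 1:]" "fps_X"] nilpotent_matsD[OF assms]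
  by (auto simp: eval_mat_X coeff_pCons fps_X_nth split: nat.splits)

lemma fps_mat_add:
  assumes "N \<in> nilpotent_mats n"
  shows "fps_mat n (F + G) N = fps_mat n F N + fps_mat n G N"
  using assms by (simp add: fps_mat_def truncate_fps_add eval_mat_add nilpotent_matsD)

lemma fps_mat_diff:
  assumes "N \<in> nilpotent_mats n"
  shows "fps_mat n (F - G) N = fps_mat n F N - fps_mat n G N"
  using assms by (simp add: fps_mat_def truncate_fps_diff eval_mat_diff nilpotent_matsD)

text \<open>The product of the truncations and the truncation of the product differ only in degrees
  at least \<open>n\<close>, which are invisible at \<open>N\<close>.\<close>

lemma fps_mat_mult:
  assumes N: "N \<in> nilpotent_mats n"
  shows "fps_mat n (F * G) N = fps_mat n F N * fps_mat n G N"
proof -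
  have "fps_mat n F N * fps_mat n G N = eval_mat n (truncate_fps n F * truncate_fps n G) N"
    using N by (simp add: fps_mat_def eval_mat_mult nilpotent_matsD)
  also have "\<dots> = fps_mat n (F * G) N"
    by (rule eval_mat_eq_fps_mat[OF N])
       (auto simp: coeff_mult coeff_truncate_fps fps_mult_nth atLeast0AtMost intro!: sum.cong)
  finally show ?thesis ..
qed

lemma fps_mat_power:
  assumes N: "N \<in> nilpotent_mats n"
  shows "fps_mat n (F ^ k) N = fps_mat n F N ^\<^sub>m k"
proof (induction k)
  case 0
  have "fps_mat n (fps_const 1) N = 1\<^sub>m n"
    unfolding fps_mat_const[OF N] by (auto intro!: eq_matI)
  moreover have "dim_row (fps_mat n F N) = n"
    using fps_mat_carrier[OF N] by blast
  ultimately show ?case by simp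
next
  case (Suc k)
  then show ?case
    using fps_mat_mult[OF N, of "F ^ k" F] by (simp add: mult.commute)
qed

lemma fps_cutoff_power_nth:
  "k < n \<Longrightarrow> fps_nth (fps_cutoff n G ^ i) k = fps_nth (G ^ i) k" for G :: "'a::comm_ring_1 fps"
proof (induction i arbitrary: k)
  case (Suc i)
  then show ?case by (simp add: fps_mult_nth)
qed simp

text \<open>Since \<open>G\<close> has no constant term, the coefficient of index \<open>k\<close>
  in \<open>F oo G\<close> involves only coefficients of index at most \<open>k\<close> of
  \<open>F\<close> and \<open>G\<close>. Below \<open>n\<close> it is therefore already determined
  by the truncations, where composition is that of polynomials.\<close>

lemma fps_mat_compose:
  assumes N: "N \<in> nilpotent_mats n" and G: "fps_nth G 0 = 0"
  shows "fps_mat n (F oo G) N = fps_mat n F (fps_mat n G N)"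
proof -
  let ?F = "truncate_fps n F" and ?G = "truncate_fps n G"
  have "coeff (pcompose ?F ?G) k = fps_nth (F oo G) k" if "k < n" for k
  proof -
    have "fps_of_poly (pcompose ?F ?G) = fps_cutoff n F oo fps_cutoff n G"
      using G by (subst fps_of_poly_pcompose) (auto simp: coeff_truncate_fps)
    then have "coeff (pcompose ?F ?G) k = fps_nth (fps_cutoff n F oo fps_cutoff n G) k"
      by (metis fps_of_poly_nth)
    also have "\<dots> = fps_nth (F oo G) k"
      using that by (simp add: fps_compose_nth fps_cutoff_power_nth)
    finally show ?thesis .
  qed
  from eval_mat_eq_fps_mat[OF N this] show ?thesis
    using N by (simp add: fps_mat_def eval_mat_pcompose nilpotent_matsD)
qed

text \<open>The series \<open>F ^ n\<close> has no terms of order below \<open>n\<close>.\<close>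

lemma fps_mat_nilpotent:
  assumes N: "N \<in> nilpotent_mats n" and F: "fps_nth F 0 = 0"
  shows "fps_mat n F N \<in> nilpotent_mats n"
proof -
  have "fps_mat n F N ^\<^sub>m n = fps_mat n (F ^ n) N" by (simp add: fps_mat_power[OF N])
  also have "\<dots> = fps_mat n (fps_const 0) N"
    by (rule fps_mat_cong[OF N]) (use startsby_zero_power_prefix[OF F] in auto)
  also have "\<dots> = 0\<^sub>m n n" unfolding fps_mat_const[OF N] by (auto intro!: eq_matI)
  finally show ?thesis using N by (simp add: nilpotent_mats_def)
qed

lemma similar_mat_wit_nilpotent:
  assumes "similar_mat_wit A B S T" "A \<in> nilpotent_mats n"
  shows "B \<in> nilpotent_mats n"
proof -
  note A = nilpotent_matsD[OF assms(2)]
  note w = similar_mat_witD2[OF A(1) assms(1)]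
  have "B ^\<^sub>m n = T * A ^\<^sub>m n * S"
    by (rule similar_mat_wit_pow_id[OF similar_mat_wit_sym[OF assms(1)]])
  then show ?thesis
    using w A by (simp add: nilpotent_mats_def right_mult_zero_mat[of _ n n])
qed

lemma similar_mat_wit_fps_mat:
  assumes "similar_mat_wit A B S T" "A \<in> nilpotent_mats n"
  shows "similar_mat_wit (fps_mat n F A) (fps_mat n F B) S T"
  unfolding fps_mat_def
  by (rule similar_mat_wit_eval_mat) (use assms in \<open>auto simp: nilpotent_matsD\<close>)

subsection \<open>Nilpotent matrices and Jordan blocks\<close>

lemma nilpotent_mats_jordan_block: "jordan_block k 0 \<in> nilpotent_mats k"
  by (auto simp: nilpotent_mats_def jordan_block_zero_pow intro!: eq_matI)

lemma eval_mat_four_block: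
  assumes A: "A \<in> carrier_mat n n" and B: "B \<in> carrier_mat m m"
  shows "eval_mat (n + m) P (four_block_mat A (0\<^sub>m n m) (0\<^sub>m m n) B)
    = four_block_mat (eval_mat n P A) (0\<^sub>m n m) (0\<^sub>m m n) (eval_mat m P B)"
    (is "eval_mat _ P ?M = ?R")
proof (rule eq_matI)
  have M: "?M \<in> carrier_mat (n + m) (n + m)" using A B by auto
  fix i j assume "i < dim_row ?R" "j < dim_col ?R"
  then have ij: "i < n + m" "j < n + m" using A B by auto
  have "dim_row (A ^\<^sub>m k) = n" "dim_col (A ^\<^sub>m k) = n" "dim_row (B ^\<^sub>m k) = m"
    "dim_col (B ^\<^sub>m k) = m" for k
    using A B by auto
  then show "eval_mat (n + m) P ?M $$ (i, j) = ?R $$ (i, j)"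
    unfolding index_eval_mat[OF M le_refl ij] pow_four_block_mat[OF A B]
    using A B ij by (auto simp del: pow_mat_dim simp add: index_eval_mat[OF A le_refl] index_eval_mat[OF B le_refl])
qed (use A B in auto)

lemma mat_kernel_eval_mat_subset:
  assumes M: "M \<in> carrier_mat n n" and "coeff P 0 = 0"
  shows "mat_kernel M \<subseteq> mat_kernel (eval_mat n P M)"
proof -
  from \<open>coeff P 0 = 0\<close> obtain Q where Q: "P = pCons 0 Q" by (cases P) simp
  have "eval_mat n P M = eval_mat n Q M * M"
    unfolding Q eval_mat_pCons[OF M] using M by (auto intro!: eq_matI)
  then show ?thesis using mat_kernel_mult_subset[OF M eval_mat_carrier[OF M]] by simp
qed

text \<open>A series without constant term has the matrix as a right factor, so its kernel can only
  grow. The compositional inverse of \<open>F\<close> recovers \<open>N\<close> from its image by a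
  series of the same kind, which gives the opposite inclusion.\<close>

lemma mat_kernel_fps_mat:
  assumes N: "N \<in> nilpotent_mats n" and F: "fps_nth F 0 = 0" "fps_nth F 1 \<noteq> 0"
  shows "mat_kernel (fps_mat n F N) = mat_kernel N"
proof
  have sub: "mat_kernel N \<subseteq> mat_kernel (fps_mat n F N)"
    if "N \<in> nilpotent_mats n" "fps_nth F 0 = 0" for N F
    unfolding fps_mat_def
    by (rule mat_kernel_eval_mat_subset) (use that in \<open>auto simp: nilpotent_matsD coeff_truncate_fps\<close>)
  then show "mat_kernel N \<subseteq> mat_kernel (fps_mat n F N)" using N F by blast
  have "N = fps_mat n (fps_inv F) (fps_mat n F N)"
    using fps_mat_compose[OF N F(1), of "fps_inv F"] fps_mat_X[OF N] fps_inv[OF F] by metis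
  moreover have "fps_nth (fps_inv F) 0 = 0" by (simp add: fps_inv_def)
  ultimately show "mat_kernel (fps_mat n F N) \<subseteq> mat_kernel N"
    using sub[OF fps_mat_nilpotent[OF N F(1)]] by metis
qed

lemma char_matrix_0: "A \<in> carrier_mat n n \<Longrightarrow> char_matrix A 0 = A"
  by (auto simp: char_matrix_def intro!: eq_matI)

lemma jordan_matrix_singleton: "jordan_matrix [(k, a)] = jordan_block k a"
  by (auto simp: jordan_matrix_def jordan_block_def Let_def intro!: eq_matI)

lemma dim_gen_eigenspace_jordan_block_0:
  "dim_gen_eigenspace (jordan_block k (0::complex)) 0 j = min j k"
  using dim_gen_eigenspace_jordan_matrix[of "[(k, 0::complex)]" 0 j]
  by (simp add: jordan_matrix_singleton)

text \<open>The Jordan type is read off from dimensions: nilpotency makes the blocks for eigenvalue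
  0 fill the whole space, and a one-dimensional kernel leaves room for only one of them.\<close>

lemma similar_fps_mat_jordan_block:
  assumes F: "fps_nth F 0 = 0" "fps_nth F 1 \<noteq> 0"
  shows "similar_mat (fps_mat k F (jordan_block k 0)) (jordan_block k 0)"
proof (cases "k = 0")
  \<comment> \<open>In size 0 the kernel has dimension 0 and there is no block to count, so this
    case is separate.\<close>
  case True
  have "fps_mat k F (jordan_block k 0) \<in> carrier_mat k k"
    by (rule fps_mat_carrier[OF nilpotent_mats_jordan_block])
  moreover from this have "fps_mat k F (jordan_block k 0) = jordan_block k 0"
    using True by (auto intro!: eq_matI)
  ultimately show ?thesis by (metis similar_mat_refl)
next
  case False
  let ?J = "jordan_block k (0::complex)" and ?M = "fps_mat k F (jordan_block k 0)"
  note J = nilpotent_mats_jordan_block[of k]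
  have M: "?M \<in> nilpotent_mats k" by (rule fps_mat_nilpotent[OF J F(1)])
  note Mc = nilpotent_matsD(1)[OF M] and Jc = nilpotent_matsD(1)[OF J]
  from char_poly_factorized[OF Mc] obtain as
    where "char_poly ?M = (\<Prod>a\<leftarrow>as. [:- a, 1:])" by auto
  from jordan_nf_exists[OF Mc this] obtain bs where bs: "jordan_nf ?M bs" ..
  then have pos: "0 \<notin> fst ` set bs" and sim: "similar_mat ?M (jordan_matrix bs)"
    by (auto simp: jordan_nf_def)
  from similar_matD[OF sim] obtain m where "?M \<in> carrier_mat m m" "jordan_matrix bs \<in> carrier_mat m m"
    by auto
  with Mc jordan_matrix_dim(1)[of bs] have sum: "sum_list (map fst bs) = k"
    by (metis carrier_matD(1))
  define ns where "ns = map fst [(n, e)\<leftarrow>bs . e = 0]"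
  have dim: "dim_gen_eigenspace ?M 0 j = (\<Sum>n\<leftarrow>ns. min j n)" for j
    unfolding ns_def by (rule dim_gen_eigenspace[OF bs])
  \<comment> \<open>Both \<open>k\<close>-th powers are zero, so both generalized eigenspaces are
    the full space.\<close>
  have "dim_gen_eigenspace ?M 0 k = dim_gen_eigenspace ?J 0 k"
    unfolding dim_gen_eigenspace_def char_matrix_0[OF Mc] char_matrix_0[OF Jc]
    using nilpotent_matsD(2)[OF J] nilpotent_matsD(2)[OF M] by simp
  then have k: "(\<Sum>n\<leftarrow>ns. min k n) = k"
    unfolding dim dim_gen_eigenspace_jordan_block_0 by simp
  \<comment> \<open>Equal kernels give equal dimensions; as block sizes are positive, this dimension
    is the number of blocks for eigenvalue 0.\<close>
  have "dim_gen_eigenspace ?M 0 1 = dim_gen_eigenspace ?J 0 1"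
    unfolding dim_gen_eigenspace_def char_matrix_0[OF Mc] char_matrix_0[OF Jc] kernel_dim_def
    using Mc Jc mat_kernel_fps_mat[OF J F] by simp
  then have "(\<Sum>n\<leftarrow>ns. min 1 n) = 1"
    unfolding dim dim_gen_eigenspace_jordan_block_0 using False by simp
  moreover have ns_pos: "\<forall>n\<in>set ns. n > 0" using pos by (force simp: ns_def)
  then have "(\<Sum>n\<leftarrow>ns. min 1 n) = length ns" by (induction ns) auto
  ultimately have "length ns = Suc 0" by simp
  then obtain a where a: "ns = [a]" by (auto simp: length_Suc_conv)
  with k have "a \<ge> k" by simp
  have "a \<in> set ns" using a by simp
  then have "(a, 0) \<in> set bs" by (auto simp: ns_def)
  \<comment> \<open>A block of size at least \<open>k\<close> exhausts the total size
    \<open>k\<close>, so no further block remains, for whatever eigenvalue.\<close>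
  then obtain xs ys where xy: "bs = xs @ (a, 0) # ys" by (auto dest: split_list)
  with sum have "sum_list (map fst xs) + (a + sum_list (map fst ys)) = k" by simp
  with \<open>a \<ge> k\<close> have "a = k" "sum_list (map fst xs) = 0" "sum_list (map fst ys) = 0" by linarith+
  moreover have "0 \<notin> set (map fst xs)" "0 \<notin> set (map fst ys)" using pos xy by auto
  ultimately have "xs = []" "ys = []" by (cases xs; cases ys; simp)+
  with xy \<open>a = k\<close> sim show ?thesis by (simp add: jordan_matrix_singleton)
qed

section \<open>Direct sums of nilpotent Jordan blocks\<close>

abbreviation jordan_matrix_0 :: "nat list \<Rightarrow> complex mat" where
  "jordan_matrix_0 ks \<equiv> jordan_matrix (map (\<lambda>k. (k, 0)) ks)"

lemma jordan_matrix_0_carrier: "jordan_matrix_0 ks \<in> carrier_mat (sum_list ks) (sum_list ks)"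
  using jordan_matrix_carrier[of "map (\<lambda>k. (k, 0::complex)) ks"] by (simp add: comp_def)

lemma jordan_matrix_0_Cons:
  "jordan_matrix_0 (k # ks) = four_block_mat (jordan_block k 0) (0\<^sub>m k (sum_list ks))
     (0\<^sub>m (sum_list ks) k) (jordan_matrix_0 ks)"
  by (simp add: jordan_matrix_Cons comp_def)

text \<open>The exponent is free above the total size so that the induction hypothesis for the
  shorter list applies with the same \<open>m\<close>.\<close>

lemma jordan_matrix_0_pow:
  "m \<ge> sum_list ks \<Longrightarrow> jordan_matrix_0 ks ^\<^sub>m m = 0\<^sub>m (sum_list ks) (sum_list ks)"
proof (induction ks)
  case Nil
  show ?case by (rule eq_matI) (auto simp: comp_def)
next
  case (Cons k ks)
  let ?s = "sum_list ks"
  have *: "jordan_block k 0 ^\<^sub>m m = (0\<^sub>m k k :: complex mat)"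
    using Cons.prems pow_mat_nilpotent_ge[OF nilpotent_matsD[OF nilpotent_mats_jordan_block], of k m]
    by simp
  have "jordan_matrix_0 ks ^\<^sub>m m = 0\<^sub>m ?s ?s" using Cons by simp
  moreover have "four_block_mat (0\<^sub>m k k) (0\<^sub>m k ?s) (0\<^sub>m ?s k) (0\<^sub>m ?s ?s)
      = (0\<^sub>m (k + ?s) (k + ?s) :: complex mat)"
    by (rule eq_matI) auto
  ultimately show ?case
    by (simp only: jordan_matrix_0_Cons * sum_list.Cons
        pow_four_block_mat[OF jordan_block_carrier jordan_matrix_0_carrier])
qed

text \<open>Evaluation acts block by block. A fixed polynomial replaces the series because the
  truncation in \<open>fps_mat\<close> depends on the size, which varies with the block.\<close>

lemma similar_eval_mat_jordan_matrix_0: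
  assumes P: "coeff P 0 = 0" "coeff P 1 \<noteq> 0"
  shows "similar_mat (eval_mat (sum_list ks) P (jordan_matrix_0 ks)) (jordan_matrix_0 ks)"
proof (induction ks)
  case Nil
  have "jordan_matrix_0 [] \<in> carrier_mat 0 0" using jordan_matrix_0_carrier[of "[]"] by simp
  moreover from this have "eval_mat 0 P (jordan_matrix_0 []) = jordan_matrix_0 []"
    by (intro eq_matI) auto
  ultimately show ?case by (simp add: similar_mat_refl)
next
  case (Cons k ks)
  have "eval_mat k P (jordan_block k 0) = fps_mat k (fps_of_poly P) (jordan_block k 0)"
    by (rule eval_mat_eq_fps_mat[OF nilpotent_mats_jordan_block]) simp
  then have "similar_mat (eval_mat k P (jordan_block k 0)) (jordan_block k 0)"
    using similar_fps_mat_jordan_block[of "fps_of_poly P" k] P by simp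
  from similar_mat_four_block_0_0[OF this Cons.IH eval_mat_carrier[OF jordan_block_carrier]
      eval_mat_carrier[OF jordan_matrix_0_carrier]]
  show ?case
    unfolding jordan_matrix_0_Cons
    using eval_mat_four_block[OF jordan_block_carrier jordan_matrix_0_carrier] by simp
qed

lemma ex_similar_jordan_matrix_0:
  fixes N :: "complex mat"
  assumes N: "N \<in> carrier_mat n n" and ev: "\<And>e. eigenvalue N e \<Longrightarrow> e = 0"
  shows "\<exists>ks. sum_list ks = n \<and> similar_mat N (jordan_matrix_0 ks)"
proof -
  from char_poly_factorized[OF N] obtain as
    where "char_poly N = (\<Prod>a\<leftarrow>as. [:- a, 1:])" by auto
  from jordan_nf_exists[OF N this] obtain bs where bs: "jordan_nf N bs" ..
  then have pos: "0 \<notin> fst ` set bs" and sim: "similar_mat N (jordan_matrix bs)"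
    by (auto simp: jordan_nf_def)
  have "e = 0" if "(k, e) \<in> set bs" for k e
  proof -
    \<comment> \<open>Positive block size makes \<open>e\<close> a root of its factor of the
      characteristic polynomial.\<close>
    have "k \<noteq> 0" using pos that by force
    then have "poly ([:- e, 1:] ^ k) e = 0" by simp
    moreover from split_list[OF that] obtain xs ys where "bs = xs @ (k, e) # ys" by blast
    ultimately have "poly (char_poly N) e = 0"
      unfolding jordan_nf_char_poly[OF bs] by simp
    then have "eigenvalue N e" using eigenvalue_root_char_poly[OF N] by simp
    then show ?thesis by (rule ev)
  qed
  then have "(\<lambda>x. (fst x, 0)) x = x" if "x \<in> set bs" for x
    using that by (cases x) simp
  then have "map (\<lambda>k. (k, 0)) (map fst bs) = bs" unfolding map_map comp_def by (rule map_idI)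
  with sim have sim': "similar_mat N (jordan_matrix_0 (map fst bs))" by metis
  from similar_matD[OF sim'] obtain m
    where "N \<in> carrier_mat m m" "jordan_matrix_0 (map fst bs) \<in> carrier_mat m m" by blast
  with N jordan_matrix_0_carrier[of "map fst bs"] have "sum_list (map fst bs) = n"
    by (metis carrier_matD(1))
  with sim' show ?thesis by blast
qed

lemma eigenvalues_0_imp_nilpotent:
  fixes N :: "complex mat"
  assumes N: "N \<in> carrier_mat n n" and ev: "\<And>e. eigenvalue N e \<Longrightarrow> e = 0"
  shows "N \<in> nilpotent_mats n"
proof -
  from ex_similar_jordan_matrix_0[OF assms] obtain ks
    where ks: "sum_list ks = n" "similar_mat N (jordan_matrix_0 ks)" by blast
  then have "jordan_matrix_0 ks \<in> nilpotent_mats n"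
    using jordan_matrix_0_carrier[of ks] jordan_matrix_0_pow[of ks n] by (simp add: nilpotent_mats_def)
  with similar_mat_sym[OF ks(2)] show ?thesis
    unfolding similar_mat_def using similar_mat_wit_nilpotent by blast
qed

text \<open>With J the Jordan form of \<open>N\<close>, the similarities are chained: P(N) to P(J)
  by the same witnesses, P(J) to J blockwise, and J back to \<open>N\<close>.\<close>

lemma similar_fps_mat:
  fixes N :: "complex mat"
  assumes N: "N \<in> carrier_mat n n" and ev: "\<And>e. eigenvalue N e \<Longrightarrow> e = 0"
    and F: "fps_nth F 0 = 0" "fps_nth F 1 \<noteq> 0"
  shows "similar_mat N (fps_mat n F N)"
proof -
  from ex_similar_jordan_matrix_0[OF N ev] obtain ks S T
    where ks: "sum_list ks = n" and wit: "similar_mat_wit N (jordan_matrix_0 ks) S T"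
    unfolding similar_mat_def by blast
  have nil: "N \<in> nilpotent_mats n" by (rule eigenvalues_0_imp_nilpotent[OF N ev])
  \<comment> \<open>For \<open>n \<le> 1\<close> a truncation at degree \<open>n\<close> would lose the linear coefficient.\<close>
  define P where "P = truncate_fps (n + 2) F"
  have P: "coeff P 0 = 0" "coeff P 1 \<noteq> 0" using F by (auto simp: P_def coeff_truncate_fps)
  have eq: "eval_mat n P N = fps_mat n F N"
    by (rule eval_mat_eq_fps_mat[OF nil]) (simp add: P_def coeff_truncate_fps)
  have "similar_mat (eval_mat n P N) (eval_mat n P (jordan_matrix_0 ks))"
    using similar_mat_wit_eval_mat[OF wit N] unfolding similar_mat_def by blast
  moreover have "similar_mat (eval_mat n P (jordan_matrix_0 ks)) (jordan_matrix_0 ks)"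
    using similar_eval_mat_jordan_matrix_0[OF P, of ks] ks by simp
  moreover have "similar_mat (jordan_matrix_0 ks) N"
    using similar_mat_wit_sym[OF wit] unfolding similar_mat_def by blast
  ultimately show ?thesis
    unfolding eq by (blast intro: similar_mat_trans similar_mat_sym)
qed

subsection \<open>Conjugators of powers\<close>

lemma GL_D:
  assumes "B \<in> GL n"
  shows "B \<in> carrier_mat n n" "inv\<^bsub>cmat_ring n\<^esub> B \<in> carrier_mat n n"
    "B * inv\<^bsub>cmat_ring n\<^esub> B = 1\<^sub>m n" "inv\<^bsub>cmat_ring n\<^esub> B * B = 1\<^sub>m n"
proof -
  interpret ring "cmat_ring n" by (rule ring_mat)
  show "B \<in> carrier_mat n n" "inv\<^bsub>cmat_ring n\<^esub> B \<in> carrier_mat n n"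
    "B * inv\<^bsub>cmat_ring n\<^esub> B = 1\<^sub>m n" "inv\<^bsub>cmat_ring n\<^esub> B * B = 1\<^sub>m n"
    using Units_closed[OF assms] Units_inv_closed[OF assms] Units_r_inv[OF assms]
      Units_l_inv[OF assms] by (simp_all add: ring_mat_simps)
qed

lemma GL_I:
  assumes "B \<in> carrier_mat n n" "C \<in> carrier_mat n n" "B * C = 1\<^sub>m n" "C * B = 1\<^sub>m n"
  shows "B \<in> GL n" "inv\<^bsub>cmat_ring n\<^esub> B = C"
proof -
  interpret ring "cmat_ring n" by (rule ring_mat)
  show "B \<in> GL n" using assms by (auto simp: Units_def ring_mat_simps)
  show "inv\<^bsub>cmat_ring n\<^esub> B = C"
    using inv_unique'[of B C] assms by (simp add: ring_mat_simps)
qed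

lemma similar_mat_wit_conj:
  assumes "B \<in> GL n" "X \<in> carrier_mat n n"
  shows "similar_mat_wit (inv\<^bsub>cmat_ring n\<^esub> B * X * B) X (inv\<^bsub>cmat_ring n\<^esub> B) B"
  using GL_D[OF assms(1)] assms(2) by (intro similar_mat_witI[of _ _ n]) auto

text \<open>Multiplying by \<open>B\<close> on the left and by the inverse of \<open>C\<close> on
  the right is injective and turns the first equation into the second. This is what makes the set of
  conjugators a coset of the commutant.\<close>

lemma conj_eq_iff_commute:
  assumes B: "B \<in> GL n" and C: "C \<in> GL n" and N: "N \<in> carrier_mat n n"
  shows "inv\<^bsub>cmat_ring n\<^esub> B * N * B = inv\<^bsub>cmat_ring n\<^esub> C * N * C
    \<longleftrightarrow> (B * inv\<^bsub>cmat_ring n\<^esub> C) * N = N * (B * inv\<^bsub>cmat_ring n\<^esub> C)"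
proof -
  let ?B = "inv\<^bsub>cmat_ring n\<^esub> B" and ?C = "inv\<^bsub>cmat_ring n\<^esub> C"
  note c = GL_D(1,2)[OF B] GL_D(1,2)[OF C]
  have l: "B * (?B * N * B) * ?C = N * (B * ?C)"
  proof -
    have "B * (?B * N * B) * ?C = (B * ?B) * N * (B * ?C)"
      using N c by (simp add: assoc_mult_mat[of _ n n _ n _ n])
    then show ?thesis using N c GL_D(3)[OF B] by simp
  qed
  have r: "B * (?C * N * C) * ?C = (B * ?C) * N"
  proof -
    have "B * (?C * N * C) * ?C = (B * ?C) * N * (C * ?C)"
      using N c by (simp add: assoc_mult_mat[of _ n n _ n _ n])
    then show ?thesis using N c GL_D(3)[OF C]
      by (simp add: right_mult_one_mat[of _ n n])
  qed
  have cancel: "?B * (B * X * ?C) * C = X" if "X \<in> carrier_mat n n" for X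
  proof -
    have "?B * (B * X * ?C) * C = (?B * B) * X * (?C * C)"
      using that c by (simp add: assoc_mult_mat[of _ n n _ n _ n])
    then show ?thesis using that c GL_D(4)[OF B] GL_D(4)[OF C] by simp
  qed
  have d: "?B * N * B \<in> carrier_mat n n" "?C * N * C \<in> carrier_mat n n"
    using N c by auto
  show ?thesis
    using l r cancel[OF d(1)] cancel[OF d(2)] by metis
qed

section \<open>Integer powers as power series and the conjugation equation\<close>

lemma fps_mat_linear:
  assumes N: "N \<in> nilpotent_mats n"
  shows "fps_mat n (fps_const lam + fps_X) N = N + lam \<cdot>\<^sub>m 1\<^sub>m n"
  unfolding fps_mat_add[OF N] fps_mat_const[OF N] fps_mat_X[OF N]
  using nilpotent_matsD(1)[OF N] by (intro comm_add_mat) auto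

lemma fps_mat_1:
  assumes N: "N \<in> nilpotent_mats n"
  shows "fps_mat n 1 N = 1\<^sub>m n"
  using fps_mat_const[OF N, of 1] by (auto intro!: eq_matI)

text \<open>For nonzero \<open>lam\<close> the series \<open>fps_const lam + fps_X\<close> is
  invertible, and evaluation carries its inverse to the matrix inverse; this covers negative
  exponents.\<close>

lemma int_pow_mat_eq_fps_mat:
  assumes N: "N \<in> nilpotent_mats n" and "lam \<noteq> 0"
  shows "(N + lam \<cdot>\<^sub>m 1\<^sub>m n) [^]\<^bsub>cmat_ring n\<^esub> p = fps_mat n ((fps_const lam + fps_X) powi p) N"
proof -
  let ?L = "fps_const lam + fps_X" and ?A = "N + lam \<cdot>\<^sub>m 1\<^sub>m n"
  have L: "inverse ?L * ?L = 1" using \<open>lam \<noteq> 0\<close> by (intro inverse_mult_eq_1) simp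
  have "?A \<in> carrier_mat n n" using nilpotent_matsD(1)[OF N] by simp
  from pow_mat_ring_pow[OF this, where b = "()"]
  have pow: "?A [^]\<^bsub>cmat_ring n\<^esub> k = fps_mat n (?L ^ k) N" for k :: nat
    unfolding fps_mat_power[OF N] fps_mat_linear[OF N] by simp
  have "inv\<^bsub>cmat_ring n\<^esub> fps_mat n (?L ^ k) N = fps_mat n (inverse ?L ^ k) N" for k
  proof (rule GL_I(2))
    have "inverse ?L ^ k * ?L ^ k = 1" "?L ^ k * inverse ?L ^ k = 1"
      unfolding power_mult_distrib[symmetric] L mult.commute[of ?L] by simp_all
    then show "fps_mat n (?L ^ k) N * fps_mat n (inverse ?L ^ k) N = 1\<^sub>m n"
      "fps_mat n (inverse ?L ^ k) N * fps_mat n (?L ^ k) N = 1\<^sub>m n"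
      unfolding fps_mat_mult[OF N, symmetric] by (simp_all only: fps_mat_1[OF N])
  qed (use N in auto)
  then show ?thesis
    by (simp add: int_pow_def2 power_int_def pow)
qed

lemma fps_linear_power_int_nth:
  fixes lam :: complex
  assumes "lam \<noteq> 0"
  shows "fps_nth ((fps_const lam + fps_X) powi p) 0 = lam powi p"
    and "p \<noteq> 0 \<Longrightarrow> fps_nth ((fps_const lam + fps_X) powi p) 1 \<noteq> 0"
proof -
  let ?L = "fps_const lam + fps_X"
  have "?L * inverse ?L = 1" using assms by (intro inverse_mult_eq_1') simp
  \<comment> \<open>Comparing linear coefficients here determines that of \<open>inverse ?L\<close>,
    which is the input for negative \<open>p\<close>.\<close>
  then have "fps_nth (?L * inverse ?L) 1 = 0" by simp
  then have "lam * fps_nth (inverse ?L) 1 + inverse lam = 0"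
    by (simp add: fps_mult_nth)
  then have inv1: "fps_nth (inverse ?L) 1 \<noteq> 0" using assms by auto
  show "fps_nth (?L powi p) 0 = lam powi p"
    by (simp add: power_int_def fps_power_zeroth)
  show "fps_nth (?L powi p) 1 \<noteq> 0" if "p \<noteq> 0"
    using that assms inv1[unfolded One_nat_def] by (simp add: power_int_def fps_power_first[unfolded One_nat_def])
qed

lemma ex_fps_conjugation:
  assumes N: "N \<in> nilpotent_mats n" and "lam \<noteq> 0" "p \<noteq> 0" "q \<noteq> 0" and pq: "lam powi p = lam powi q"
  obtains P where "fps_nth P 0 = 0" "fps_nth P 1 \<noteq> 0"
    "\<And>B. B \<in> GL n \<Longrightarrow>
      inv\<^bsub>cmat_ring n\<^esub> B * ((N + lam \<cdot>\<^sub>m 1\<^sub>m n) [^]\<^bsub>cmat_ring n\<^esub> p) * B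
        = (N + lam \<cdot>\<^sub>m 1\<^sub>m n) [^]\<^bsub>cmat_ring n\<^esub> q
      \<longleftrightarrow> inv\<^bsub>cmat_ring n\<^esub> B * N * B = fps_mat n P N"
proof -
  let ?L = "fps_const lam + fps_X"
  \<comment> \<open>The common constant coefficient of both powers, by \<open>pq\<close>; removing
    it makes \<open>f\<close> and \<open>h\<close> invertible under composition.\<close>
  define c where "c = fps_const (lam powi p)"
  define f where "f = ?L powi p - c"
  define h where "h = ?L powi q - c"
  note nth = fps_linear_power_int_nth[OF \<open>lam \<noteq> 0\<close>]
  have f: "fps_nth f 0 = 0" "fps_nth f 1 \<noteq> 0"
    using nth[of p] \<open>p \<noteq> 0\<close> by (simp_all add: f_def c_def)
  have h: "fps_nth h 0 = 0" "fps_nth h 1 \<noteq> 0"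
    using nth[of q] \<open>q \<noteq> 0\<close> pq by (simp_all add: h_def c_def)
  define g where "g = fps_inv f"
  have gf: "g oo f = fps_X" "f oo g = fps_X"
    unfolding g_def by (rule fps_inv[OF f] fps_inv_right[OF f])+
  have g: "fps_nth g 0 = 0" by (simp add: g_def fps_inv_def)
  \<comment> \<open>The chain rule at 0; applied to \<open>g oo f = fps_X\<close> it shows that
    \<open>g\<close> has a nonzero linear coefficient.\<close>
  have compose1: "fps_nth (F oo G) 1 = fps_nth F 1 * fps_nth G 1"
    if "fps_nth F 0 = 0" "fps_nth G 0 = 0" for F G :: "complex fps"
    using that by (simp add: fps_compose_nth)
  have g1: "fps_nth g 1 \<noteq> 0" using compose1[OF g f(1)] gf(1) by auto
  define P where "P = g oo h"
  have P: "fps_nth P 0 = 0" "fps_nth P 1 \<noteq> 0"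
    using g g1 h compose1[OF g h(1)] by (simp_all add: P_def)
  have "f oo P = h" unfolding P_def
    using fps_compose_assoc[OF h(1) g, of f] gf h(1) by simp
  then have fP: "?L powi p oo P = ?L powi q"
    by (simp add: f_def h_def c_def fps_compose_sub_distrib)
  have "inv\<^bsub>cmat_ring n\<^esub> B * ((N + lam \<cdot>\<^sub>m 1\<^sub>m n) [^]\<^bsub>cmat_ring n\<^esub> p) * B
        = (N + lam \<cdot>\<^sub>m 1\<^sub>m n) [^]\<^bsub>cmat_ring n\<^esub> q
      \<longleftrightarrow> inv\<^bsub>cmat_ring n\<^esub> B * N * B = fps_mat n P N" if B: "B \<in> GL n" for B
  proof -
    define M where "M = inv\<^bsub>cmat_ring n\<^esub> B * N * B"
    have wit: "similar_mat_wit N M B (inv\<^bsub>cmat_ring n\<^esub> B)"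
      unfolding M_def
      by (rule similar_mat_wit_sym[OF similar_mat_wit_conj[OF B nilpotent_matsD(1)[OF N]]])
    have M: "M \<in> nilpotent_mats n" by (rule similar_mat_wit_nilpotent[OF wit N])
    \<comment> \<open>Conjugation passes inside the series, so the equation for powers becomes one
      between series at \<open>M\<close> and at \<open>N\<close>.\<close>
    have conj: "inv\<^bsub>cmat_ring n\<^esub> B * fps_mat n F N * B = fps_mat n F M" for F
      using similar_mat_wit_sym[OF similar_mat_wit_fps_mat[OF wit N, of F]]
        similar_mat_witD2(3)[OF fps_mat_carrier[OF M]] by metis
    have "fps_mat n (?L powi p) M = fps_mat n (?L powi q) N \<longleftrightarrow> M = fps_mat n P N"
    proof
      assume "M = fps_mat n P N"
      then show "fps_mat n (?L powi p) M = fps_mat n (?L powi q) N"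
        using fps_mat_compose[OF N P(1), of "?L powi p"] fP by simp
    next
      assume eq: "fps_mat n (?L powi p) M = fps_mat n (?L powi q) N"
      have "fps_mat n f M = fps_mat n h N"
        unfolding f_def h_def fps_mat_diff[OF M] fps_mat_diff[OF N] eq
        unfolding c_def fps_mat_const[OF M] fps_mat_const[OF N] ..
      \<comment> \<open>Applying \<open>g\<close> undoes \<open>f\<close> on the left and produces
        \<open>P = g oo h\<close> on the right.\<close>
      then have "fps_mat n g (fps_mat n f M) = fps_mat n g (fps_mat n h N)" by simp
      then show "M = fps_mat n P N"
        unfolding fps_mat_compose[OF M f(1), symmetric] fps_mat_compose[OF N h(1), symmetric] gf P_def
          fps_mat_X[OF M] .
    qed
    then show ?thesis
      unfolding int_pow_mat_eq_fps_mat[OF N \<open>lam \<noteq> 0\<close>] conj M_def[symmetric] .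
  qed
  with P show thesis by (rule that)
qed

section \<open>Polynomials of least degree with a prescribed value at a matrix\<close>

text \<open>The polynomials with value \<open>X\<close> form a coset of the ideal annihilating
  \<open>N\<close>. Two distinct minimizers would differ by a nonzero annihilator of no larger
  degree, and reducing one of them by it would lower the degree.\<close>

lemma ex1_arg_min_eval_mat:
  assumes n: "n \<ge> 1" and N: "N \<in> carrier_mat n n"
    and conj: "\<And>Q. R Q \<longleftrightarrow> eval_mat n Q N = X" and ex: "R Q\<^sub>0"
  shows "\<exists>!P. is_arg_min degree R P"
proof -
  from ex_has_least_nat[of R Q\<^sub>0 degree, OF ex] obtain P
    where P: "R P" "\<And>Q. R Q \<Longrightarrow> degree P \<le> degree Q" by blast
  show ?thesis
  proof (rule ex1I)
    show "is_arg_min degree R P" using P by (auto simp: is_arg_min_def not_less)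
  next
    fix Q assume Q: "is_arg_min degree R Q"
    then have "R Q" and deg: "degree Q = degree P"
      using P by (auto simp: is_arg_min_linorder intro: antisym)
    define D where "D = P - Q"
    have D: "eval_mat n D N = 0\<^sub>m n n"
      using P(1) \<open>R Q\<close> N unfolding D_def eval_mat_diff[OF N] conj by auto
    have "degree D \<le> degree P" using deg by (simp add: D_def degree_diff_le)
    have "D = 0"
    proof (rule ccontr)
      assume "D \<noteq> 0"
      show False
      proof (cases "degree P = 0")
        \<comment> \<open>The zero polynomial also has \<open>degree\<close> 0, so cancelling a
          leading term cannot lower this degree. Instead, a nonzero constant does not annihilate a
          matrix of size at least 1.\<close>
        case True
        with \<open>degree D \<le> degree P\<close> obtain d where d: "D = [:d:]" by (metis degree_eq_zeroE le_zero_eq)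
        with \<open>D \<noteq> 0\<close> have "d \<noteq> 0" by simp
        have "(d \<cdot>\<^sub>m 1\<^sub>m n) $$ (0, 0) = (0\<^sub>m n n :: complex mat) $$ (0, 0)"
          using D unfolding d eval_mat_const[OF N] by simp
        then show False using n \<open>d \<noteq> 0\<close> by simp
      next
        case False
        \<comment> \<open>Cancel the leading coefficient of \<open>P\<close> against a multiple of \<open>D\<close>.\<close>
        define T where "T = P - monom (lead_coeff P / lead_coeff D) (degree P - degree D) * D"
        have "degree (monom (lead_coeff P / lead_coeff D) (degree P - degree D) * D) \<le> degree P"
          using degree_mult_le[of "monom (lead_coeff P / lead_coeff D) (degree P - degree D)" D]
            degree_monom_le[of "lead_coeff P / lead_coeff D" "degree P - degree D"]
            \<open>degree D \<le> degree P\<close> by linarith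
        then have "degree T \<le> degree P" by (simp add: T_def degree_diff_le)
        moreover have "coeff T (degree P) = 0"
          using \<open>D \<noteq> 0\<close> \<open>degree D \<le> degree P\<close>
          by (simp add: T_def coeff_monom_mult)
        ultimately have "degree T < degree P"
          using False by (metis eq_zero_or_degree_less degree_0 neq0_conv)
        moreover have "R T"
          using P(1) N unfolding conj T_def eval_mat_diff[OF N] eval_mat_mult[OF N] D
          by (auto simp: right_mult_zero_mat[of _ n n])
        ultimately show False using P(2) by (meson not_less)
      qed
    qed
    then show "Q = P" by (simp add: D_def)
  qed
qed

theorem proposition4:
  fixes p q :: int and n :: nat and A N :: "complex mat" and lam :: complex
  assumes "coprime p q" and "\<bar>p\<bar> + \<bar>q\<bar> > 2"
    and "n \<ge> 1"
    and "A \<in> GL n"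
    and "spectrum A = {lam}"
    and "lam powi (q - p) = 1"
    and "N = A - lam \<cdot>\<^sub>m 1\<^sub>m n"
  shows "similar_mat (A [^]\<^bsub>cmat_ring n\<^esub> p) (A [^]\<^bsub>cmat_ring n\<^esub> q)
    \<and> (\<exists>!P. is_arg_min degree (conjugate_poly n A p q lam) P)
    \<and> (\<forall>P. is_arg_min degree (conjugate_poly n A p q lam) P \<longrightarrow>
          (\<exists>B\<^sub>0 \<in> GL n.
             inv\<^bsub>cmat_ring n\<^esub> B\<^sub>0 * N * B\<^sub>0 = eval_mat n P N \<and>
             power_conjugators n A p q = {\<Delta> * B\<^sub>0 | \<Delta>. \<Delta> \<in> mat_commutant n N}))"
proof -
  interpret R: ring "cmat_ring n" by (rule ring_mat)
  \<comment> \<open>If one exponent were 0, coprimality would force the other to be 1 or -1, and the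
    sum of absolute values would be 1.\<close>
  have "p \<noteq> 0" "q \<noteq> 0" using assms(1,2) by auto
  note A = GL_D(1)[OF \<open>A \<in> GL n\<close>]
  have N: "N \<in> carrier_mat n n" using A assms(7) by auto
  have AN: "A = N + lam \<cdot>\<^sub>m 1\<^sub>m n" using A assms(7) by (auto intro!: eq_matI)
  have "eigenvalue A lam" using assms(5) by (auto simp: spectrum_def)
  then obtain v where v: "v \<in> carrier_vec n" "v \<noteq> 0\<^sub>v n" "A *\<^sub>v v = lam \<cdot>\<^sub>v v"
    using A by (auto simp: eigenvalue_def eigenvector_def)
  \<comment> \<open>Otherwise \<open>v\<close> would be a nonzero vector in the kernel of the
    invertible matrix \<open>A\<close>.\<close>
  have "lam \<noteq> 0"
  proof
    assume "lam = 0"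
    let ?B = "inv\<^bsub>cmat_ring n\<^esub> A"
    note i = GL_D[OF \<open>A \<in> GL n\<close>]
    have z: "lam \<cdot>\<^sub>v v = 0\<^sub>v n" using v(1) \<open>lam = 0\<close> by (auto intro!: eq_vecI)
    have "v = (?B * A) *\<^sub>v v" using i v by simp
    also have "\<dots> = ?B *\<^sub>v (0\<^sub>v n)" using i(1,2) v z by (simp add: assoc_mult_mat_vec[of _ n n _ n])
    also have "\<dots> = 0\<^sub>v n" using i(2) by auto
    finally show False using v by simp
  qed
  have ev: "e = 0" if "eigenvalue N e" for e
  proof -
    from that obtain w where w: "w \<in> carrier_vec n" "w \<noteq> 0\<^sub>v n" "N *\<^sub>v w = e \<cdot>\<^sub>v w"
      using N by (auto simp: eigenvalue_def eigenvector_def)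
    have "A *\<^sub>v w = N *\<^sub>v w + (lam \<cdot>\<^sub>m 1\<^sub>m n) *\<^sub>v w"
      unfolding AN using N w(1) by (intro add_mult_distrib_mat_vec) auto
    also have "(lam \<cdot>\<^sub>m 1\<^sub>m n) *\<^sub>v w = lam \<cdot>\<^sub>v w"
      using w(1) by (auto intro!: eq_vecI)
    finally have "A *\<^sub>v w = (e + lam) \<cdot>\<^sub>v w" using w by (simp add: add_smult_distrib_vec)
    then have "e + lam \<in> spectrum A"
      using w A by (auto simp: spectrum_def eigenvalue_def eigenvector_def)
    then show ?thesis using assms(5) by simp
  qed
  note nil = eigenvalues_0_imp_nilpotent[OF N ev]
  have "lam powi p = lam powi q"
    using assms(6) \<open>lam \<noteq> 0\<close> by (simp add: power_int_diff)
  from ex_fps_conjugation[OF nil \<open>lam \<noteq> 0\<close> \<open>p \<noteq> 0\<close> \<open>q \<noteq> 0\<close> this] obtain F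
    where F: "fps_nth F 0 = 0" "fps_nth F 1 \<noteq> 0"
      and iff: "\<And>B. B \<in> GL n \<Longrightarrow>
        inv\<^bsub>cmat_ring n\<^esub> B * (A [^]\<^bsub>cmat_ring n\<^esub> p) * B = A [^]\<^bsub>cmat_ring n\<^esub> q
        \<longleftrightarrow> inv\<^bsub>cmat_ring n\<^esub> B * N * B = fps_mat n F N"
    unfolding AN by blast
  have conjugators: "power_conjugators n A p q
      = {B \<in> GL n. inv\<^bsub>cmat_ring n\<^esub> B * N * B = fps_mat n F N}"
    using iff by (auto simp: power_conjugators_def)
  from similar_fps_mat[OF N ev F] obtain S T where wit: "similar_mat_wit N (fps_mat n F N) S T"
    unfolding similar_mat_def by blast
  note w = similar_mat_witD2[OF N wit]
  \<comment> \<open>The witnesses give \<open>N = S * fps_mat n F N * T\<close> with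
    \<open>T\<close> inverse to \<open>S\<close>, so conjugating \<open>N\<close> by
    \<open>S\<close> yields the series value.\<close>
  define B\<^sub>0 where "B\<^sub>0 = S"
  have B0: "B\<^sub>0 \<in> GL n" "inv\<^bsub>cmat_ring n\<^esub> B\<^sub>0 = T"
    unfolding B\<^sub>0_def by (rule GL_I[OF w(6,7,1,2)])+
  have conj0: "inv\<^bsub>cmat_ring n\<^esub> B\<^sub>0 * N * B\<^sub>0 = fps_mat n F N"
    unfolding B0(2) unfolding B\<^sub>0_def
    using similar_mat_witD2(3)[OF w(5) similar_mat_wit_sym[OF wit]] by simp
  have conj_poly: "conjugate_poly n A p q lam Q \<longleftrightarrow> eval_mat n Q N = fps_mat n F N" for Q
  proof -
    have "inv\<^bsub>cmat_ring n\<^esub> B * A * B - lam \<cdot>\<^sub>m 1\<^sub>m n = inv\<^bsub>cmat_ring n\<^esub> B * N * B" if "B \<in> GL n" for B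
    proof -
      let ?B = "inv\<^bsub>cmat_ring n\<^esub> B"
      note i = GL_D[OF that]
      have "?B * A * B = (?B * N + ?B * (lam \<cdot>\<^sub>m 1\<^sub>m n)) * B"
        unfolding AN using i N by (subst mult_add_distrib_mat[of _ n n _ n]) auto
      also have "?B * (lam \<cdot>\<^sub>m 1\<^sub>m n) = lam \<cdot>\<^sub>m ?B"
        using i by (simp add: mult_smult_distrib[of _ n n _ n])
      also have "(?B * N + lam \<cdot>\<^sub>m ?B) * B = ?B * N * B + lam \<cdot>\<^sub>m ?B * B"
        using i N by (subst add_mult_distrib_mat[of _ n n]) auto
      also have "lam \<cdot>\<^sub>m ?B * B = lam \<cdot>\<^sub>m 1\<^sub>m n"
        using i by (simp add: mult_smult_assoc_mat[of _ n n])
      finally show ?thesis using i N by (auto intro!: eq_matI)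
    qed
    then have "conjugate_poly n A p q lam Q
        \<longleftrightarrow> (\<forall>B \<in> power_conjugators n A p q. fps_mat n F N = eval_mat n Q N)"
      unfolding conjugate_poly_def assms(7)[symmetric] by (auto simp: conjugators)
    \<comment> \<open>\<open>B\<^sub>0\<close> is a conjugator, so the quantifier is not vacuous and
      the condition amounts to this single equation.\<close>
    also have "\<dots> \<longleftrightarrow> eval_mat n Q N = fps_mat n F N"
      using B0(1) conj0 by (auto simp: conjugators)
    finally show ?thesis .
  qed
  have coset: "power_conjugators n A p q = {\<Delta> * B\<^sub>0 | \<Delta>. \<Delta> \<in> mat_commutant n N}"
  proof (intro equalityI subsetI)
    fix B assume "B \<in> power_conjugators n A p q"
    then have B: "B \<in> GL n" and eq: "inv\<^bsub>cmat_ring n\<^esub> B * N * B = inv\<^bsub>cmat_ring n\<^esub> B\<^sub>0 * N * B\<^sub>0"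
      unfolding conj0 by (auto simp: conjugators)
    \<comment> \<open>The quotient of two conjugators is the element of the commutant
      sought.\<close>
    let ?D = "B * inv\<^bsub>cmat_ring n\<^esub> B\<^sub>0"
    have "?D * N = N * ?D" using conj_eq_iff_commute[OF B B0(1) N] eq by simp
    moreover have "?D \<in> GL n"
      using R.Units_m_closed[OF B R.Units_inv_Units[OF B0(1)]] by (simp add: ring_mat_simps)
    moreover have "B = ?D * B\<^sub>0"
      using GL_D[OF B] GL_D[OF B0(1)] by (simp add: assoc_mult_mat[of _ n n _ n _ n])
    ultimately show "B \<in> {\<Delta> * B\<^sub>0 | \<Delta>. \<Delta> \<in> mat_commutant n N}"
      unfolding mat_commutant_def by blast
  next
    fix B assume "B \<in> {\<Delta> * B\<^sub>0 | \<Delta>. \<Delta> \<in> mat_commutant n N}"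
    then obtain D where D: "D \<in> GL n" "D * N = N * D" and BD: "B = D * B\<^sub>0"
      by (auto simp: mat_commutant_def)
    have B: "B \<in> GL n"
      unfolding BD using R.Units_m_closed[OF D(1) B0(1)] by (simp add: ring_mat_simps)
    have "B * inv\<^bsub>cmat_ring n\<^esub> B\<^sub>0 = D"
      unfolding BD using GL_D[OF D(1)] GL_D[OF B0(1)]
      by (simp add: assoc_mult_mat[of _ n n _ n _ n])
    then have "inv\<^bsub>cmat_ring n\<^esub> B * N * B = inv\<^bsub>cmat_ring n\<^esub> B\<^sub>0 * N * B\<^sub>0"
      using conj_eq_iff_commute[OF B B0(1) N] D by simp
    then show "B \<in> power_conjugators n A p q" using B by (simp add: conjugators conj0)
  qed
  have "A [^]\<^bsub>cmat_ring n\<^esub> p \<in> carrier_mat n n"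
    using int_pow_mat_eq_fps_mat[OF nil \<open>lam \<noteq> 0\<close>, of p] nil unfolding AN by simp
  from similar_mat_wit_conj[OF B0(1) this]
  have "similar_mat_wit (A [^]\<^bsub>cmat_ring n\<^esub> q) (A [^]\<^bsub>cmat_ring n\<^esub> p) (inv\<^bsub>cmat_ring n\<^esub> B\<^sub>0) B\<^sub>0"
    using iff[OF B0(1)] conj0 by simp
  then have "similar_mat (A [^]\<^bsub>cmat_ring n\<^esub> p) (A [^]\<^bsub>cmat_ring n\<^esub> q)"
    unfolding similar_mat_def using similar_mat_wit_sym by blast
  moreover have "\<exists>!P. is_arg_min degree (conjugate_poly n A p q lam) P"
    \<comment> \<open>The truncation of \<open>F\<close> shows that some polynomial satisfies the
      condition; it need not itself have least degree.\<close>
    by (rule ex1_arg_min_eval_mat[OF \<open>n \<ge> 1\<close> N conj_poly, of "truncate_fps n F"])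
       (simp add: conj_poly fps_mat_def)
  moreover have "inv\<^bsub>cmat_ring n\<^esub> B\<^sub>0 * N * B\<^sub>0 = eval_mat n P N"
    if "is_arg_min degree (conjugate_poly n A p q lam) P" for P
    using that conj0 conj_poly[of P] by (simp add: is_arg_min_def)
  ultimately show ?thesis using B0(1) coset by blast
qed

end
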